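(* Let $A$ be a proper submodule of $\mathbb{C}[x,y]$ (that is, $A\neq \mathbb{C}[x,y]$). Then there are integers $d\ge 0$ and $s\ge 1$ such that $A=M_d+M$, where $M$ is an L-module of order $s$.
   Context: A submodule (or module) of $\mathbb{C}[x,y]$ is a translation invariant linear subspace of $\mathbb{C}[x,y]$; equivalently, a linear subspace closed under the partial derivatives $\partial/\partial x$ and $\partial/\partial y$. Every $F\in \mathbb{C}[x,y]$ can be written uniquely as $F(x,y)=\sum_{n=0}^\infty f_n(x)\frac{y^n}{n!}$ with $f_n\in \mathbb{C}[x]$ and $f_n=0$ for all large $n$; the coordinate polynomials of $F$ are $[F]_n=f_n$. For a positive integer $s$, a set $M\subset\mathbb{C}[x,y]$ is an L-module of order $s$ if $M$ is a module and, whenever $F\in M$ and $[F]_n=0$ for every $n<s$, then $F=0$. For an integer $d\ge 0$, $M_d=\{F\in\mathbb{C}[x,y]\colon \deg [F]_n<d \text{ for every } n\}$, where the zero polynomial has degree $-\infty$; so $M_0=\{0\}$ and $M_1=\mathbb{C}[y]$. The sum of sets $A,B\subset \mathbb{C}[x,y]$ is $A+B=\{f+g\colon f\in A, g\in B\}$. *)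

theory Defs
  imports "HOL-Computational_Algebra.Polynomial" "HOL-Library.Set_Algebras" Complex_Main
begin

text \<open>A polynomial in two variables x, y over the complex numbers is an element of
  \<open>\<complex>[x][y]\<close>: the outer polynomial variable is y, and the coefficients are polynomials in x.\<close>

type_synonym bipoly = "complex poly poly"

definition bieval :: "bipoly \<Rightarrow> complex \<Rightarrow> complex \<Rightarrow> complex"
  where "bieval F x y = poly (poly F [:y:]) x"

definition biscale :: "complex \<Rightarrow> bipoly \<Rightarrow> bipoly"
  where "biscale c F = smult [:c:] F"

definition translate :: "complex \<Rightarrow> complex \<Rightarrow> bipoly \<Rightarrow> bipoly"
  where "translate a b F = pcompose (map_poly (\<lambda>f. pcompose f [:a, 1:]) F) [:[:b:], 1:]"

lemma bieval_biscale: "bieval (biscale c F) x y = c * bieval F x y"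
  by (simp add: bieval_def biscale_def)

lemma bieval_translate: "bieval (translate a b F) x y = bieval F (x + a) (y + b)"
proof -
  have "poly (poly (map_poly (\<lambda>f. pcompose f [:a, 1:]) F) [:c:]) x = poly (poly F [:c:]) (x + a)"
    for c
    by (induction F) (simp_all add: map_poly_pCons poly_pcompose add.commute)
  then show ?thesis
    by (simp add: bieval_def translate_def poly_pcompose add.commute)
qed

lemma vector_space_biscale: "vector_space biscale"
  by unfold_locales
    (simp_all add: biscale_def smult_add_right smult_add_left [symmetric] one_pCons [symmetric] mult.commute)

text \<open>Submodules in the sense of translation invariant linear subspaces (not ideals).\<close>

definition is_submodule :: "bipoly set \<Rightarrow> bool"
  where "is_submodule A \<longleftrightarrow>
    module.subspace biscale A \<and> (\<forall>F\<in>A. \<forall>a b. translate a b F \<in> A)"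

text \<open>The factorial stems from expanding in the powers \<open>y ^ n / n!\<close>.\<close>

definition coord :: "bipoly \<Rightarrow> nat \<Rightarrow> complex poly"
  where "coord F n = smult (fact n) (coeff F n)"

definition L_module :: "nat \<Rightarrow> bipoly set \<Rightarrow> bool"
  where "L_module s M \<longleftrightarrow>
    is_submodule M \<and> (\<forall>F\<in>M. (\<forall>n<s. coord F n = 0) \<longrightarrow> F = 0)"

lemma coord_expansion:
  "bieval F x y = (\<Sum>n\<le>degree F. poly (coord F n) x * (y ^ n / fact n))"
proof -
  have "poly F [:y:] = (\<Sum>n\<le>degree F. coeff F n * [:y:] ^ n)"
    by (simp add: poly_altdef)
  then have "bieval F x y = (\<Sum>n\<le>degree F. poly (coeff F n) x * y ^ n)"
    by (simp add: bieval_def poly_sum poly_power)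
  then show ?thesis
    by (simp add: coord_def)
qed

text \<open>The zero polynomial has library degree 0 but counts as having degree \<open>-\<infinity>\<close> here, so it is
  admitted separately.\<close>

definition M_deg :: "nat \<Rightarrow> bipoly set"
  where "M_deg d = {F. \<forall>n. coord F n = 0 \<or> degree (coord F n) < d}"

end

theory Submission imports Defs begin

text \<open>
  The proof rests on the duality between polynomials and power series in the derivatives. A linear
  functional \<open>\<phi>\<close> on \<open>\<complex>[x,y]\<close> is the same thing as a power series
  \<open>g = \<Sum> \<phi>(x\<^sup>i y\<^sup>j / (i! j!)) X\<^sup>i Y\<^sup>j\<close>, and \<open>g(\<partial>/\<partial>x, \<partial>/\<partial>y)\<close> is a well-defined operator on polynomials,
  since all high derivatives of a polynomial vanish. By Taylor's formula the value at \<open>(a, b)\<close>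
  of this operator applied to \<open>F\<close> is \<open>\<phi>\<close> of the translate of \<open>F\<close> by \<open>(a, b)\<close>
  (\<open>bieval_symbol_op\<close>). So the operator commutes with translations, and if \<open>\<phi>\<close> vanishes on a
  submodule, the operator kills that submodule.

  Let \<open>A\<close> be a proper submodule, and \<open>d\<close> maximal with \<open>M\<^sub>d \<subseteq> A\<close>; it exists because the
  increasing sets \<open>M\<^sub>d\<close> start with \<open>{0}\<close> and exhaust \<open>\<complex>[x,y]\<close>. Choose \<open>\<phi>\<close> that vanishes on
  \<open>A\<close> but not at some \<open>F \<in> M\<^sub>d\<^sub>+\<^sub>1\<close>. As \<open>\<phi>\<close> vanishes on \<open>M\<^sub>d\<close>, its series is \<open>X\<^sup>d h\<close>; as it does
  not vanish on \<open>M\<^sub>d\<^sub>+\<^sub>1\<close>, the series \<open>h(0, Y)\<close> is nonzero, of some order \<open>s\<close>. Write \<open>T\<close> for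
  the operator with symbol \<open>h\<close>. Because \<open>X\<^sup>d h\<close> kills \<open>A\<close>, the operator \<open>T\<close> maps \<open>A\<close> into
  \<open>M\<^sub>d\<close> (\<open>submodule_mapped_into_M_deg\<close>).

  The regularity of \<open>h\<close> has two consequences, both read off from the action of \<open>T\<close> on
  \<open>M\<^sub>1 = \<complex>[y]\<close>, where \<open>T\<close> kills the polynomials of degree below \<open>s\<close>
  and lowers the degree of the others by exactly \<open>s\<close>. An element of \<open>ker T\<close> is
  determined by its first \<open>s\<close> coordinates (\<open>y_regular_kernel_trivial\<close>), and \<open>T\<close> maps \<open>M\<^sub>d\<close>
  onto itself (\<open>y_regular_surj_M_deg\<close>). Take \<open>M = A \<inter> ker T\<close>, an L-module by the first
  property. For \<open>G \<in> A\<close> the second one gives \<open>P \<in> M\<^sub>d\<close> with \<open>T P = T G\<close>, and then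
  \<open>G = P + (G - P)\<close> with \<open>G - P \<in> M\<close>.
\<close>

section \<open>Linear algebra on bivariate polynomials\<close>

interpretation bipoly: vector_space biscale
  by (rule vector_space_biscale)

interpretation bipoly_functional: vector_space_pair biscale "(*) :: complex \<Rightarrow> complex \<Rightarrow> complex"
  by unfold_locales (simp_all add: algebra_simps)

interpretation bipoly_endo: vector_space_pair biscale biscale
  by unfold_locales

abbreviation functional :: "(bipoly \<Rightarrow> complex) \<Rightarrow> bool"
  where "functional \<equiv> Vector_Spaces.linear biscale (*)"

lemma functional_sum_biscale:
  assumes "functional \<phi>"
  shows "\<phi> (\<Sum>i\<in>S. biscale (c i) (G i)) = (\<Sum>i\<in>S. c i * \<phi> (G i))"
  using assms
  by (simp add: bipoly_functional.linear_sum bipoly_functional.linear_scale)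

lemma functional_separates_subspace:
  assumes "bipoly.subspace A" and "F \<notin> A"
  obtains \<phi> where "functional \<phi>" and "\<And>G. G \<in> A \<Longrightarrow> \<phi> G = 0" and "\<phi> F = 1"
proof -
  obtain B where B: "B \<subseteq> A" "bipoly.independent B" "A \<subseteq> bipoly.span B"
    by (rule bipoly.maximal_independent_subset)
  then have span: "bipoly.span B = A"
    using assms(1) bipoly.span_subspace by blast
  then have "bipoly.independent (insert F B)"
    using assms(2) B by (simp add: bipoly.independent_insertI)
  then obtain \<phi> where \<phi>: "functional \<phi>" "\<forall>G\<in>insert F B. \<phi> G = (if G = F then 1 else 0)"
    using bipoly_functional.linear_independent_extend[of "insert F B" "\<lambda>G. if G = F then 1 else 0"]
    by metis
  have "\<phi> G = 0" if "G \<in> A" for G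
  proof (rule bipoly_functional.linear_eq_0_on_span)
    show "\<phi> H = 0" if "H \<in> B" for H
      using that \<phi>(2) B(1) assms(2) by auto
  qed (use \<phi>(1) span that in auto)
  with \<phi> show thesis
    using that by simp
qed

lemma coeff_biscale [simp]: "coeff (biscale c F) n = smult c (coeff F n)"
  by (simp add: biscale_def)

lemma coord_eq_0_iff [simp]: "coord F n = 0 \<longleftrightarrow> coeff F n = 0"
  by (simp add: coord_def)

lemma bieval_sum: "bieval (sum G S) x y = (\<Sum>i\<in>S. bieval (G i) x y)"
  by (simp add: bieval_def poly_sum)

text \<open>For fixed \<open>x\<close> the two polynomials in \<open>y\<close> agree on the infinite field \<open>\<complex>\<close>, so their coefficients
  agree at \<open>x\<close>; these are polynomials in \<open>x\<close> that agree on \<open>\<complex>\<close>.\<close>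

lemma bieval_eqI:
  assumes "\<And>x y. bieval F x y = bieval G x y"
  shows "F = G"
proof -
  have "poly (map_poly (\<lambda>f. poly f x) F) y = bieval F x y" for F x y
    by (induction F) (simp_all add: bieval_def map_poly_pCons)
  then have "poly (map_poly (\<lambda>f. poly f x) F) = poly (map_poly (\<lambda>f. poly f x) G)" for x
    using assms by (simp add: fun_eq_iff)
  then have "map_poly (\<lambda>f. poly f x) F = map_poly (\<lambda>f. poly f x) G" for x
    by (simp only: poly_eq_poly_eq_iff)
  then have "poly (coeff F n) x = poly (coeff G n) x" for x n
    by (metis coeff_map_poly poly_0)
  then have "poly (coeff F n) = poly (coeff G n)" for n
    by (simp add: fun_eq_iff)
  then show ?thesis
    by (simp add: poly_eq_iff poly_eq_poly_eq_iff)
qed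

section \<open>Partial derivatives and the Taylor formula\<close>

definition Dx :: "bipoly \<Rightarrow> bipoly"
  where "Dx = map_poly pderiv"

abbreviation Dy :: "bipoly \<Rightarrow> bipoly"
  where "Dy \<equiv> pderiv"

lemma coeff_Dx_power [simp]: "coeff ((Dx ^^ k) F) n = (pderiv ^^ k) (coeff F n)"
  by (induction k) (simp_all add: Dx_def coeff_map_poly)

lemma coeff_Dx [simp]: "coeff (Dx F) n = pderiv (coeff F n)"
  by (simp add: Dx_def coeff_map_poly)

lemma Dx_Dy_power_commute: "(Dx ^^ k) ((Dy ^^ l) F) = (Dy ^^ l) ((Dx ^^ k) F)"
proof -
  have "Dx (Dy G) = Dy (Dx G)" for G
    by (rule poly_eqI) (simp add: coeff_pderiv pderiv_mult del: of_nat_Suc)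
  then have "(Dx ^^ k) (Dy G) = Dy ((Dx ^^ k) G)" for G
    by (induction k) simp_all
  then show ?thesis
    by (induction l) simp_all
qed

lemma linear_Dx_power: "Vector_Spaces.linear biscale biscale (Dx ^^ k)"
  by (auto simp: Vector_Spaces.linear_iff vector_space_biscale higher_pderiv_add higher_pderiv_smult
      intro!: poly_eqI [where 'a = "complex poly"])

lemma linear_Dy_power: "Vector_Spaces.linear biscale biscale (Dy ^^ k)"
  by (simp add: Vector_Spaces.linear_iff vector_space_biscale higher_pderiv_add higher_pderiv_smult biscale_def)

lemma higher_pderiv_eq_0_iff:
  fixes f :: "complex poly"
  shows "(pderiv ^^ d) f = 0 \<longleftrightarrow> f = 0 \<or> degree f < d"
proof (induction d arbitrary: f)
  case (Suc d)
  show ?case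
    by (simp add: Suc.IH funpow_Suc_right degree_pderiv pderiv_eq_0_iff del: funpow.simps) auto
qed auto

text \<open>This turns degree conditions into equations that every operator commuting with
  \<open>\<partial>/\<partial>x\<close> preserves, and makes inductions on \<open>d\<close> possible one derivative at a time.\<close>

lemma M_deg_eq_kernel: "M_deg d = {F. (Dx ^^ d) F = 0}"
  by (auto simp: M_deg_def poly_eq_iff [of "(Dx ^^ d) _"] higher_pderiv_eq_0_iff coord_def)

lemma mem_M_deg_mono: "F \<in> M_deg d \<Longrightarrow> d \<le> e \<Longrightarrow> F \<in> M_deg e"
  by (fastforce simp: M_deg_def)

lemma ex_mem_M_deg: "\<exists>d. F \<in> M_deg d"
proof -
  have "degree (coeff F n) < Suc (\<Sum>m\<le>degree F. degree (coeff F m))" if "n \<le> degree F" for n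
    using that by (intro le_imp_less_Suc member_le_sum) auto
  then have "F \<in> M_deg (Suc (\<Sum>m\<le>degree F. degree (coeff F m)))"
    by (auto simp: M_deg_def coord_def intro: le_degree)
  then show ?thesis ..
qed

lemma surj_Dx_power: "surj (Dx ^^ d)"
proof -
  \<comment> \<open>the antiderivative with constant term 0\<close>
  define J :: "complex poly \<Rightarrow> complex poly"
    where "J f = (\<Sum>i\<le>degree f. monom (coeff f i / of_nat (Suc i)) (Suc i))" for f
  have "pderiv (J f) = f" for f
    using higher_pderiv_sum [of 1 "\<lambda>i. monom (coeff f i / of_nat (Suc i)) (Suc i)" "{..degree f}"]
    by (simp add: J_def pderiv_monom poly_as_sum_of_monoms del: of_nat_Suc)
  moreover have "J 0 = 0"
    by (simp add: J_def)
  ultimately have "Dx (map_poly J F) = F" for F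
    by (intro poly_eqI) (simp add: coeff_map_poly)
  then have "surj Dx"
    by (metis surjI)
  then show ?thesis
    by (rule surj_fn)
qed

lemma poly_sum_up_to:
  fixes p :: "'a::comm_semiring_1 poly"
  assumes "degree p \<le> N"
  shows "poly p x = (\<Sum>i\<le>N. coeff p i * x ^ i)"
  using assms unfolding poly_altdef
  by (intro sum.mono_neutral_left) (auto simp: coeff_eq_0)

lemma Taylor_poly:
  fixes f :: "complex poly"
  assumes "degree f \<le> N"
  shows "poly f (x + a) = (\<Sum>k\<le>N. a ^ k / fact k * poly ((pderiv ^^ k) f) x)"
proof -
  \<comment> \<open>\<open>g(t) = f(x + t)\<close>: its coefficients are its derivatives at 0, which are those of \<open>f\<close> at \<open>x\<close>\<close>
  define g where "g = pcompose f [:x, 1:]"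
  have "(pderiv ^^ k) g = pcompose ((pderiv ^^ k) f) [:x, 1:]" for k
    by (induction k) (simp_all add: g_def pderiv_pcompose pderiv_pCons)
  moreover have "coeff g k = poly ((pderiv ^^ k) g) 0 / fact k" for k
    by (simp add: poly_0_coeff_0 coeff_higher_pderiv flip: pochhammer_fact)
  ultimately have coeff: "coeff g k = poly ((pderiv ^^ k) f) x / fact k" for k
    by (simp add: poly_pcompose)
  have "poly f (x + a) = poly g a"
    by (simp add: g_def poly_pcompose)
  also have "degree g = degree f"
    by (simp add: g_def degree_pcompose)
  then have "poly g a = (\<Sum>k\<le>N. coeff g k * a ^ k)"
    using assms by (simp add: poly_sum_up_to) 
  finally show ?thesis
    by (simp add: coeff mult.commute)
qed

lemma bieval_add_y:
  assumes "degree F \<le> N"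
  shows "bieval F x (y + b) = (\<Sum>l\<le>N. b ^ l / fact l * bieval ((Dy ^^ l) F) x y)"
proof -
  define at_x where "at_x G = map_poly (\<lambda>f. poly f x) G" for G
  have bieval: "bieval G x z = poly (at_x G) z" for G z
    by (induction G) (simp_all add: bieval_def at_x_def map_poly_pCons)
  have "at_x (Dy G) = pderiv (at_x G)" for G
    by (rule poly_eqI) (simp add: at_x_def coeff_map_poly coeff_pderiv del: of_nat_Suc)
  then have "at_x ((Dy ^^ l) G) = (pderiv ^^ l) (at_x G)" for l G
    by (induction l) simp_all
  moreover have "degree (at_x F) \<le> N"
    using assms by (intro degree_le) (simp add: at_x_def coeff_map_poly coeff_eq_0)
  ultimately show ?thesis
    by (simp add: bieval Taylor_poly)
qed

lemma bieval_add_x: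
  assumes "F \<in> M_deg N"
  shows "bieval F (x + a) y = (\<Sum>k\<le>N. a ^ k / fact k * bieval ((Dx ^^ k) F) x y)"
proof -
  have "poly (Dx G) [:y:] = pderiv (poly G [:y:])" for G
    by (induction G) (simp_all add: Dx_def map_poly_pCons pderiv_add pderiv_smult pderiv_mult pderiv_pCons)
  then have at_y: "poly ((Dx ^^ k) G) [:y:] = (pderiv ^^ k) (poly G [:y:])" for k G
    by (induction k) simp_all
  have "(pderiv ^^ N) (poly F [:y:]) = 0"
    using assms by (simp add: M_deg_eq_kernel flip: at_y)
  then have "degree (poly F [:y:]) \<le> N"
    by (auto simp: higher_pderiv_eq_0_iff)
  then show ?thesis
    by (simp add: bieval_def Taylor_poly at_y)
qed

lemma translate_Taylor:
  assumes "degree F \<le> N" and "F \<in> M_deg N"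
  shows "translate a b F =
    (\<Sum>k\<le>N. \<Sum>l\<le>N. biscale (a ^ k * b ^ l / (fact k * fact l)) ((Dx ^^ k) ((Dy ^^ l) F)))"
proof (rule bieval_eqI)
  fix x y
  have "degree ((Dx ^^ k) F) \<le> N" for k
    using assms(1) by (intro degree_le) (simp add: coeff_eq_0)
  then have "bieval ((Dx ^^ k) F) x (y + b)
      = (\<Sum>l\<le>N. b ^ l / fact l * bieval ((Dx ^^ k) ((Dy ^^ l) F)) x y)" for k
    using bieval_add_y [of "(Dx ^^ k) F" N] by (simp add: Dx_Dy_power_commute)
  then have "bieval (translate a b F) x y = (\<Sum>k\<le>N. a ^ k / fact k *
      (\<Sum>l\<le>N. b ^ l / fact l * bieval ((Dx ^^ k) ((Dy ^^ l) F)) x y))"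
    using bieval_add_x [OF assms(2), of x a "y + b"] by (simp only: bieval_translate)
  also have "\<dots> = (\<Sum>k\<le>N. \<Sum>l\<le>N.
      a ^ k * b ^ l / (fact k * fact l) * bieval ((Dx ^^ k) ((Dy ^^ l) F)) x y)"
    by (simp add: sum_distrib_left)
  finally show "bieval (translate a b F) x y = bieval (\<Sum>k\<le>N. \<Sum>l\<le>N.
      biscale (a ^ k * b ^ l / (fact k * fact l)) ((Dx ^^ k) ((Dy ^^ l) F))) x y"
    by (simp only: bieval_sum bieval_biscale)
qed

lemma coeff_of_kernel_Dx:
  assumes "Dx F = 0"
  shows "coeff F n = [:coeff (coeff F n) 0:]"
proof -
  have "pderiv (coeff F n) = 0"
    using assms coeff_Dx by (metis coeff_0)
  then show ?thesis
    by (metis pderiv_eq_0_iff degree_0_id)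
qed

section \<open>Infinite-order differential operators with constant coefficients\<close>

text \<open>With \<open>g = \<Sum> \<phi>(x\<^sup>i y\<^sup>j / (i! j!)) X\<^sup>i Y\<^sup>j\<close> this is \<open>g(\<partial>/\<partial>x, \<partial>/\<partial>y) F\<close>, written down through its
  Taylor coefficients at the origin: evaluating \<open>g(\<partial>/\<partial>x, \<partial>/\<partial>y)\<close> of a polynomial at the origin is
  applying \<open>\<phi>\<close> to it. Only finitely many of the coefficients are nonzero when \<open>\<phi>\<close> is linear, so
  that \<open>Abs_poly\<close> is meaningful.\<close>

definition symbol_op :: "(bipoly \<Rightarrow> complex) \<Rightarrow> bipoly \<Rightarrow> bipoly"
  where "symbol_op \<phi> F = Abs_poly (\<lambda>l. Abs_poly (\<lambda>k.
    \<phi> ((Dx ^^ k) ((Dy ^^ l) F)) / (fact k * fact l)))"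

lemma coeff_symbol_op:
  assumes "functional \<phi>"
  shows "coeff (coeff (symbol_op \<phi> F) l) k = \<phi> ((Dx ^^ k) ((Dy ^^ l) F)) / (fact k * fact l)"
proof -
  define h where "h l k = \<phi> ((Dx ^^ k) ((Dy ^^ l) F)) / (fact k * fact l)" for l k
  have \<phi>0: "\<phi> 0 = 0"
    using assms by (rule bipoly_functional.linear_0)
  obtain d where d: "F \<in> M_deg d"
    using ex_mem_M_deg by blast
  have "h l k = 0" if "k \<ge> d" for l k
    using mem_M_deg_mono [OF d that] \<phi>0
    by (simp add: h_def Dx_Dy_power_commute M_deg_eq_kernel)
  then have inner: "coeff (Abs_poly (h l)) = h l" for l
    by (intro coeff_Abs_poly [of d]) auto
  have "(Dy ^^ l) F = 0" if "l > degree F" for l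
    using that by (intro poly_eqI) (simp add: coeff_higher_pderiv coeff_eq_0)
  then have "h l = (\<lambda>k. 0)" if "l > degree F" for l
    using that \<phi>0 by (simp add: h_def fun_eq_iff bipoly_endo.linear_0 [OF linear_Dx_power])
  then have "coeff (Abs_poly (\<lambda>l. Abs_poly (h l))) = (\<lambda>l. Abs_poly (h l))"
    by (intro coeff_Abs_poly [of "degree F"]) (simp add: zero_poly.abs_eq)
  then show ?thesis
    by (simp add: symbol_op_def inner flip: h_def)
qed

text \<open>This is Taylor's formula with \<open>\<phi>\<close> applied to it. It ties the operator to translates directly:
  from it \<open>symbol_op\<close> commutes with translations, and annihilates every translation-invariant set on
  which \<open>\<phi>\<close> vanishes.\<close>

lemma bieval_symbol_op:
  assumes "functional \<phi>"
  shows "bieval (symbol_op \<phi> F) a b = \<phi> (translate a b F)"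
proof -
  obtain d where "F \<in> M_deg d"
    using ex_mem_M_deg by blast
  define N where "N = max d (degree F)"
  have N: "F \<in> M_deg N" "degree F \<le> N"
    using mem_M_deg_mono [OF \<open>F \<in> M_deg d\<close>] by (simp_all add: N_def)
  define G where "G = symbol_op \<phi> F"
  note coeff_G = coeff_symbol_op [OF assms, of F, folded G_def]
  have \<phi>0: "\<phi> 0 = 0"
    using assms by (rule bipoly_functional.linear_0)
  have "(Dx ^^ k) ((Dy ^^ l) F) = 0" if "k > N" for k l
    using mem_M_deg_mono [OF N(1), of k] that bipoly_endo.linear_0 [OF linear_Dy_power]
    by (simp add: M_deg_eq_kernel Dx_Dy_power_commute)
  then have degx: "degree (coeff G l) \<le> N" for l
    using \<phi>0 by (intro degree_le) (simp add: coeff_G)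
  have "(Dx ^^ k) ((Dy ^^ l) F) = 0" if "l > N" for k l
  proof -
    have "(Dy ^^ l) F = 0"
      using that N(2) by (intro poly_eqI) (simp add: coeff_higher_pderiv coeff_eq_0)
    then show ?thesis
      by (simp add: bipoly_endo.linear_0 [OF linear_Dx_power])
  qed
  then have degy: "degree G \<le> N"
    using \<phi>0 by (intro degree_le allI impI poly_eqI) (simp add: coeff_G)
  have "poly G [:b:] = (\<Sum>l\<le>N. coeff G l * [:b:] ^ l)"
    using degy by (rule poly_sum_up_to)
  then have "bieval G a b = (\<Sum>l\<le>N. poly (coeff G l) a * b ^ l)"
    by (simp add: bieval_def poly_sum)
  also have "\<dots> = (\<Sum>l\<le>N. \<Sum>k\<le>N. a ^ k * b ^ l / (fact k * fact l) * \<phi> ((Dx ^^ k) ((Dy ^^ l) F)))"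
    by (simp only: poly_sum_up_to [OF degx] coeff_G sum_distrib_right)
      (simp add: mult.commute mult.left_commute)
  also have "\<dots> = \<phi> (translate a b F)"
    by (subst sum.swap)
      (simp add: translate_Taylor [OF N(2,1)] bipoly_functional.linear_sum [OF assms]
        bipoly_functional.linear_scale [OF assms])
  finally show ?thesis
    by (simp add: G_def)
qed

lemma symbol_op_translate:
  assumes "functional \<phi>"
  shows "symbol_op \<phi> (translate a b F) = translate a b (symbol_op \<phi> F)"
proof -
  have "translate x y (translate a b F) = translate (x + a) (y + b) F" for x y
    by (rule bieval_eqI) (simp add: bieval_translate add.assoc)
  then show ?thesis
    by (intro bieval_eqI) (simp add: bieval_symbol_op [OF assms] bieval_translate)
qed

lemma linear_symbol_op:
  assumes "functional \<phi>"
  shows "Vector_Spaces.linear biscale biscale (symbol_op \<phi>)"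
  using linear_Dx_power linear_Dy_power assms
  by (auto intro!: poly_eqI simp: Vector_Spaces.linear_iff vector_space_biscale coeff_symbol_op [OF assms]
      add_divide_distrib)

lemma symbol_op_Dx_power:
  assumes "functional \<phi>"
  shows "symbol_op \<phi> ((Dx ^^ d) F) = (Dx ^^ d) (symbol_op \<phi> F)"
proof -
  have "(Dx ^^ k) ((Dy ^^ l) (Dx G)) = (Dx ^^ Suc k) ((Dy ^^ l) G)" for k l G
    using Dx_Dy_power_commute [of 1 l G] by (simp add: funpow_swap1)
  then have "symbol_op \<phi> (Dx G) = Dx (symbol_op \<phi> G)" for G
    by (intro poly_eqI) (simp add: coeff_symbol_op [OF assms] coeff_pderiv divide_simps
      del: funpow.simps of_nat_Suc)
  then show ?thesis
    by (induction d) simp_all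
qed

text \<open>Precomposing the functional with \<open>\<partial>/\<partial>x\<close> multiplies its power series by \<open>X\<close>.\<close>

lemma symbol_op_compose_Dx_power:
  assumes "functional \<phi>"
  shows "symbol_op (\<phi> \<circ> (Dx ^^ d)) F = (Dx ^^ d) (symbol_op \<phi> F)"
proof -
  have "functional (\<phi> \<circ> (Dx ^^ d))"
    using linear_Dx_power assms by (rule Vector_Spaces.linear_compose)
  moreover have "(Dx ^^ d) ((Dx ^^ k) G) = (Dx ^^ k) ((Dx ^^ d) G)" for k G
    by (metis add.commute comp_apply funpow_add)
  ultimately have "symbol_op (\<phi> \<circ> (Dx ^^ d)) F = symbol_op \<phi> ((Dx ^^ d) F)"
    by (intro poly_eqI) (simp add: coeff_symbol_op assms Dx_Dy_power_commute)
  then show ?thesis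
    by (simp add: symbol_op_Dx_power [OF assms])
qed

section \<open>Symbols that are regular in the second variable\<close>

text \<open>The power series \<open>h(X, Y)\<close> of \<open>\<phi>\<close> has \<open>h(0, Y)\<close> of order exactly \<open>s\<close>, as in the
  Weierstrass preparation theorem.\<close>

definition y_regular :: "nat \<Rightarrow> (bipoly \<Rightarrow> complex) \<Rightarrow> bool"
  where "y_regular s \<phi> \<longleftrightarrow> functional \<phi> \<and> (\<forall>j<s. \<phi> (monom 1 j) = 0) \<and> \<phi> (monom 1 s) \<noteq> 0"

lemma functional_on_kernel_Dx:
  assumes "functional \<phi>" and "Dx F = 0" and "degree F \<le> s"
  shows "\<phi> F = (\<Sum>j\<le>s. coeff (coeff F j) 0 * \<phi> (monom 1 j))"
proof -
  have "biscale (coeff (coeff F j) 0) (monom 1 j) = monom (coeff F j) j" for j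
    using coeff_of_kernel_Dx [OF assms(2), of j]
    by (simp add: biscale_def smult_monom)
  then have "F = (\<Sum>j\<le>s. biscale (coeff (coeff F j) 0) (monom 1 j))"
    using assms(3) by (simp add: poly_as_sum_of_monoms')
  then show ?thesis
    using functional_sum_biscale [OF assms(1)] by metis
qed

text \<open>On \<open>\<complex>[y]\<close> only \<open>h(0, Y) = c Y\<^sup>s + \<dots>\<close> acts, with \<open>c \<noteq> 0\<close>; the top coefficient of the
  result comes from \<open>c Y\<^sup>s\<close> alone. In particular a degree of at least \<open>s\<close> drops by exactly \<open>s\<close>.\<close>

lemma coeff_symbol_op_top:
  assumes "y_regular s \<phi>" and "Dx F = 0" and "degree F \<le> l + s"
  shows "coeff (symbol_op \<phi> F) l
    = smult (\<phi> (monom 1 s) * of_nat (l + s choose l)) (coeff F (l + s))"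
proof (rule poly_eqI)
  fix k
  have \<phi>: "functional \<phi>"
    using assms(1) by (simp add: y_regular_def)
  have binomial: "of_nat (pochhammer (Suc s) l) / fact l = (of_nat (l + s choose l) :: complex)"
    using pochhammer_product' [of "1 :: complex" s l]
    by (simp add: binomial_fact pochhammer_of_nat pochhammer_fact [symmetric] add.commute
        flip: of_nat_Suc)
  have Dy: "coeff ((Dy ^^ l) F) s = of_nat (pochhammer (Suc s) l) * coeff F (l + s)"
    by (simp add: coeff_higher_pderiv pochhammer_of_nat add.commute del: of_nat_Suc)
  show "coeff (coeff (symbol_op \<phi> F) l) k
    = coeff (smult (\<phi> (monom 1 s) * of_nat (l + s choose l)) (coeff F (l + s))) k"
  proof (cases k)
    case 0
    have "Dx ((Dy ^^ l) F) = 0"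
      using assms(2) Dx_Dy_power_commute [of 1 l F] by simp
    moreover have "degree ((Dy ^^ l) F) \<le> s"
      using assms(3) by (simp add: degree_higher_pderiv)
    ultimately have "\<phi> ((Dy ^^ l) F) = (\<Sum>j\<le>s. coeff (coeff ((Dy ^^ l) F) j) 0 * \<phi> (monom 1 j))"
      by (intro functional_on_kernel_Dx [OF \<phi>])
    also have "\<dots> = (\<Sum>j\<in>{s}. coeff (coeff ((Dy ^^ l) F) j) 0 * \<phi> (monom 1 j))"
      using assms(1) by (intro sum.mono_neutral_right) (auto simp: y_regular_def)
    finally have "\<phi> ((Dy ^^ l) F)
        = of_nat (pochhammer (Suc s) l) * coeff (coeff F (l + s)) 0 * \<phi> (monom 1 s)"
      by (simp add: Dy of_nat_poly)
    then show ?thesis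
      unfolding binomial [symmetric] using 0 by (simp add: coeff_symbol_op [OF \<phi>])
  next
    case (Suc m)
    have "(Dx ^^ k) F = (Dx ^^ m) (Dx F)"
      using Suc by (simp add: funpow_swap1)
    then have "(Dx ^^ k) ((Dy ^^ l) F) = 0"
      using assms(2) bipoly_endo.linear_0 [OF linear_Dx_power]
      by (simp add: Dx_Dy_power_commute)
    then show ?thesis
      using Suc coeff_of_kernel_Dx [OF assms(2), of "l + s"] bipoly_functional.linear_0 [OF \<phi>]
      by (metis coeff_symbol_op [OF \<phi>] coeff_smult coeff_pCons_Suc coeff_0 div_0 mult_zero_right)
  qed
qed

text \<open>On \<open>\<complex>[y]\<close> a nonzero \<open>F\<close> as in the assumptions would have degree at least \<open>s\<close>, so its
  leading term would survive. If \<open>F\<close> has degree at most \<open>d\<close> in \<open>x\<close>, its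
  coefficient of \<open>x\<^sup>d\<close> is, up to the factor \<open>d!\<close>, the derivative \<open>\<partial>\<^sup>d F / \<partial>x\<^sup>d \<in> \<complex>[y]\<close> which inherits the assumptions, so it vanishes and \<open>d\<close> drops.\<close>

lemma y_regular_kernel_trivial:
  assumes "y_regular s \<phi>" and "symbol_op \<phi> F = 0" and "\<forall>n<s. coeff F n = 0"
  shows "F = 0"
proof -
  have base: "F = 0" if "symbol_op \<phi> F = 0" "\<forall>n<s. coeff F n = 0" "Dx F = 0" for F
  proof (rule ccontr)
    assume "F \<noteq> 0"
    then have "coeff F (degree F) \<noteq> 0"
      by simp
    moreover from this have "s \<le> degree F"
      using that(2) leI by blast
    ultimately show False
      using coeff_symbol_op_top [OF assms(1) that(3), of "degree F - s"] that(1) assms(1)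
      by (simp add: y_regular_def)
  qed
  have "(Dx ^^ d) F = 0 \<Longrightarrow> F = 0" for d
  proof (induction d)
    case (Suc d)
    have "(Dx ^^ d) F = 0"
    proof (rule base)
      have "functional \<phi>"
        using assms(1) by (simp add: y_regular_def)
      then show "symbol_op \<phi> ((Dx ^^ d) F) = 0"
        using assms(2) bipoly_endo.linear_0 [OF linear_Dx_power]
        by (simp add: symbol_op_Dx_power)
      show "\<forall>n<s. coeff ((Dx ^^ d) F) n = 0"
        using assms(3) by simp
      show "Dx ((Dx ^^ d) F) = 0"
        using Suc.prems by simp
    qed
    then show ?case
      by (rule Suc.IH)
  qed simp
  then show ?thesis
    using ex_mem_M_deg M_deg_eq_kernel by blast
qed

text \<open>A given \<open>G \<in> \<complex>[y]\<close> is reduced to 0 by removing its top coefficient with the image of a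
  multiple of \<open>y\<^bsup>n+s\<^esup>\<close>, where \<open>n\<close> is the degree of \<open>G\<close>; that image has degree \<open>n\<close> as well.\<close>

lemma y_regular_surj_y:
  assumes "y_regular s \<phi>" and "Dx G = 0"
  shows "\<exists>P. Dx P = 0 \<and> symbol_op \<phi> P = G"
proof -
  have \<phi>: "functional \<phi>"
    using assms(1) by (simp add: y_regular_def)
  note lin = linear_symbol_op [OF \<phi>]
  have "Dx G = 0 \<Longrightarrow> \<forall>l\<ge>n. coeff G l = 0 \<Longrightarrow> \<exists>P. Dx P = 0 \<and> symbol_op \<phi> P = G" for n
  proof (induction n arbitrary: G)
    case 0
    then have "G = 0"
      by (simp add: poly_eq_iff)
    then show ?case
      using bipoly_endo.linear_0 [OF lin] by (intro exI [of _ 0]) (simp add: Dx_def)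
  next
    case (Suc n)
    define e where "e = \<phi> (monom 1 s) * of_nat (n + s choose n)"
    define P where "P = biscale (coeff (coeff G n) 0 / e) (monom 1 (n + s))"
    have "e \<noteq> 0"
      using assms(1) by (simp add: e_def y_regular_def)
    have "Dx P = 0"
      by (rule poly_eqI) (simp add: P_def pderiv_smult)
    have "degree P \<le> n + s"
      by (simp add: P_def biscale_def degree_monom_le)
    have "coeff (symbol_op \<phi> P) l = coeff G l" if "l \<ge> n" for l
    proof -
      have "coeff (symbol_op \<phi> P) l = smult (\<phi> (monom 1 s) * of_nat (l + s choose l)) (coeff P (l + s))"
        using \<open>Dx P = 0\<close> \<open>degree P \<le> n + s\<close> that by (intro coeff_symbol_op_top assms(1)) auto
      moreover have "coeff G l = 0" if "l \<noteq> n"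
        using Suc.prems(2) that \<open>l \<ge> n\<close> by simp
      ultimately show ?thesis
        using \<open>e \<noteq> 0\<close> coeff_of_kernel_Dx [OF Suc.prems(1), of n]
        by (cases "l = n") (simp_all add: P_def e_def [symmetric])
    qed
    moreover have "Dx (symbol_op \<phi> P) = 0"
      using symbol_op_Dx_power [OF \<phi>, of 1 P] \<open>Dx P = 0\<close> bipoly_endo.linear_0 [OF lin] by simp
    ultimately obtain Q where "Dx Q = 0" "symbol_op \<phi> Q = G - symbol_op \<phi> P"
      using Suc.IH [of "G - symbol_op \<phi> P"] Suc.prems
      bipoly_endo.linear_diff [OF linear_Dx_power [of 1]] by auto
    then show ?case
      using \<open>Dx P = 0\<close> bipoly_endo.linear_add [OF linear_Dx_power [of 1], of Q P]
      by (intro exI [of _ "Q + P"]) (simp add: bipoly_endo.linear_add [OF lin])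
  qed
  moreover have "\<forall>l\<ge>Suc (degree G). coeff G l = 0"
    by (simp add: coeff_eq_0)
  ultimately show ?thesis
    using assms(2) by blast
qed

text \<open>Solve \<open>T P = \<partial>\<^sup>d G / \<partial>x\<^sup>d\<close> in \<open>\<complex>[y]\<close> and integrate \<open>P\<close> \<open>d\<close> times in \<open>x\<close> to \<open>Q\<close>;
  then \<open>G - T Q\<close> has smaller degree in \<open>x\<close>.\<close>

lemma y_regular_surj_M_deg:
  assumes "y_regular s \<phi>" and "G \<in> M_deg d"
  shows "\<exists>P\<in>M_deg d. symbol_op \<phi> P = G"
proof -
  have \<phi>: "functional \<phi>"
    using assms(1) by (simp add: y_regular_def)
  note lin = linear_symbol_op [OF \<phi>]
  show ?thesis
    using assms(2)
  proof (induction d arbitrary: G)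
    case 0
    then show ?case
      using bipoly_endo.linear_0 [OF lin] by (simp add: M_deg_eq_kernel)
  next
    case (Suc d)
    then have "Dx ((Dx ^^ d) G) = 0"
      by (simp add: M_deg_eq_kernel)
    then obtain P where P: "Dx P = 0" "symbol_op \<phi> P = (Dx ^^ d) G"
      using y_regular_surj_y [OF assms(1)] by blast
    obtain Q where Q: "(Dx ^^ d) Q = P"
      using surj_Dx_power by (metis surjD)
    have "G - symbol_op \<phi> Q \<in> M_deg d"
      using P(2) Q bipoly_endo.linear_diff [OF linear_Dx_power [of d]]
      by (simp add: M_deg_eq_kernel flip: symbol_op_Dx_power [OF \<phi>])
    then obtain R where R: "R \<in> M_deg d" "symbol_op \<phi> R = G - symbol_op \<phi> Q"
      using Suc.IH by blast
    have "R + Q \<in> M_deg (Suc d)"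
      using R(1) P(1) Q bipoly_endo.linear_add [OF linear_Dx_power [of "Suc d"]]
      bipoly_endo.linear_0 [OF linear_Dx_power [of 1]]
      by (simp add: M_deg_eq_kernel)
    moreover have "symbol_op \<phi> (R + Q) = G"
      using R(2) by (simp add: bipoly_endo.linear_add [OF lin])
    ultimately show ?case
      by blast
  qed
qed

section \<open>Decomposition of a proper submodule\<close>

text \<open>The functional \<open>\<phi>\<close> that separates \<open>F\<close> from \<open>A\<close> corresponds to a series \<open>X\<^sup>d h\<close>, and
  \<open>\<psi>\<close> is the functional of \<open>h\<close>. Division by \<open>X\<^sup>d\<close> is precomposition with a \<open>d\<close>-fold
  antiderivative in \<open>x\<close>; it is a genuine division since \<open>\<phi>\<close> vanishes on \<open>M\<^sub>d\<close>, the
  ambiguity of the antiderivative.\<close>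

lemma submodule_mapped_into_M_deg:
  assumes A: "is_submodule A" and d: "M_deg d \<subseteq> A" and F: "F \<in> M_deg (Suc d)" "F \<notin> A"
  obtains s \<psi> where "y_regular s \<psi>" and "\<And>G. G \<in> A \<Longrightarrow> symbol_op \<psi> G \<in> M_deg d"
proof -
  have "bipoly.subspace A"
    using A by (simp add: is_submodule_def)
  then obtain \<phi> where \<phi>: "functional \<phi>" "\<And>G. G \<in> A \<Longrightarrow> \<phi> G = 0" "\<phi> F = 1"
    using functional_separates_subspace F(2) by blast
  obtain J where J: "Vector_Spaces.linear biscale biscale J" "(Dx ^^ d) \<circ> J = id"
    using bipoly_endo.linear_surjective_right_inverse [OF linear_Dx_power surj_Dx_power] by blast
  define \<psi> where "\<psi> = \<phi> \<circ> J"
  have \<psi>: "functional \<psi>"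
    using J(1) \<phi>(1) unfolding \<psi>_def by (rule Vector_Spaces.linear_compose)
  have \<phi>_eq: "\<phi> G = \<psi> ((Dx ^^ d) G)" for G
  proof -
    have "(Dx ^^ d) (G - J ((Dx ^^ d) G)) = 0"
      using J(2) by (simp add: bipoly_endo.linear_diff [OF linear_Dx_power] fun_eq_iff)
    then have "\<phi> (G - J ((Dx ^^ d) G)) = 0"
      using d \<phi>(2) by (auto simp: M_deg_eq_kernel)
    then show ?thesis
      by (simp add: \<psi>_def bipoly_functional.linear_diff [OF \<phi>(1)])
  qed
  define s where "s = (LEAST j. \<psi> (monom 1 j) \<noteq> 0)"
  have "\<exists>j. \<psi> (monom 1 j) \<noteq> 0"
  proof (rule ccontr)
    assume "\<nexists>j. \<psi> (monom 1 j) \<noteq> 0"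
    then have z: "\<psi> (monom 1 j) = 0" for j
      by simp
    define H where "H = (Dx ^^ d) F"
    have "Dx H = 0"
      using F(1) by (simp add: H_def M_deg_eq_kernel)
    then have "\<psi> H = 0"
      using functional_on_kernel_Dx [OF \<psi>, of H "degree H"] z by simp
    then show False
      using \<phi>_eq [of F] \<phi>(3) by (simp add: H_def)
  qed
  then have "\<psi> (monom 1 s) \<noteq> 0"
    unfolding s_def by (rule LeastI_ex)
  then have "y_regular s \<psi>"
    using \<psi> not_less_Least by (auto simp: y_regular_def s_def)
  moreover have "symbol_op \<psi> G \<in> M_deg d" if "G \<in> A" for G
  proof -
    have "bieval (symbol_op \<phi> G) a b = 0" for a b
      using that A \<phi>(2) by (simp add: bieval_symbol_op [OF \<phi>(1)] is_submodule_def)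
    then have "symbol_op \<phi> G = 0"
      by (intro bieval_eqI) (simp add: bieval_def)
    moreover have "symbol_op \<phi> G = (Dx ^^ d) (symbol_op \<psi> G)"
    proof -
      have "\<phi> = \<psi> \<circ> (Dx ^^ d)"
        using \<phi>_eq by (simp add: fun_eq_iff)
      then show ?thesis
        using symbol_op_compose_Dx_power [OF \<psi>] by simp
    qed
    ultimately show ?thesis
      by (simp add: M_deg_eq_kernel)
  qed
  ultimately show thesis
    by (rule that)
qed

theorem theorem8:
  fixes A :: "bipoly set"
  assumes "is_submodule A" and "A \<noteq> UNIV"
  shows "\<exists>(d::nat) (s::nat) M. s \<ge> 1 \<and> L_module s M \<and> A = M_deg d + M"
proof -
  have sub: "bipoly.subspace A" and trans: "\<And>F a b. F \<in> A \<Longrightarrow> translate a b F \<in> A"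
    using assms(1) by (auto simp: is_submodule_def)
  obtain N where "\<not> M_deg N \<subseteq> A"
    using assms(2) ex_mem_M_deg by (metis UNIV_eq_I subset_iff)
  moreover have "M_deg 0 \<subseteq> A"
    using bipoly.subspace_0 [OF sub] by (simp add: M_deg_eq_kernel)
  ultimately obtain d where d: "M_deg d \<subseteq> A" "\<not> M_deg (Suc d) \<subseteq> A"
    by (induction N) auto
  then obtain F where "F \<in> M_deg (Suc d)" "F \<notin> A"
    by blast
  with assms(1) d(1) obtain s \<psi>
    where reg: "y_regular s \<psi>" and into: "\<And>G. G \<in> A \<Longrightarrow> symbol_op \<psi> G \<in> M_deg d"
    using submodule_mapped_into_M_deg by blast
  have \<psi>: "functional \<psi>"
    using reg by (simp add: y_regular_def)
  note lin = linear_symbol_op [OF \<psi>]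
  define M where "M = {G \<in> A. symbol_op \<psi> G = 0}"
  have "bipoly.subspace M"
    using sub bipoly_endo.linear_0 [OF lin] bipoly_endo.linear_add [OF lin]
      bipoly_endo.linear_scale [OF lin]
    by (simp add: M_def bipoly.subspace_def)
  moreover have "translate a b G \<in> M" if "G \<in> M" for a b G
    using that trans by (simp add: M_def symbol_op_translate [OF \<psi>]) (simp add: translate_def)
  moreover have "G = 0" if "G \<in> M" "\<forall>n<Suc s. coord G n = 0" for G
    using that y_regular_kernel_trivial [OF reg] by (simp add: M_def)
  \<comment> \<open>\<open>Suc s\<close> rather than \<open>s\<close>, because \<open>s = 0\<close> is possible and the order has to be positive\<close>
  ultimately have "L_module (Suc s) M"
    by (simp add: L_module_def is_submodule_def)
  moreover have "A = M_deg d + M"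
  proof
    show "M_deg d + M \<subseteq> A"
      using d(1) bipoly.subspace_add [OF sub] by (auto simp: M_def elim!: set_plus_elim)
    show "A \<subseteq> M_deg d + M"
    proof
      fix G
      assume "G \<in> A"
      then obtain P where P: "P \<in> M_deg d" "symbol_op \<psi> P = symbol_op \<psi> G"
        using into y_regular_surj_M_deg [OF reg] by blast
      then have "G - P \<in> M"
        using \<open>G \<in> A\<close> d(1) bipoly.subspace_diff [OF sub]
        by (auto simp: M_def bipoly_endo.linear_diff [OF lin])
      then show "G \<in> M_deg d + M"
        using set_plus_intro [OF P(1), of "G - P" M] by simp
    qed
  qed
  ultimately show ?thesis
    by (intro exI [of _ d] exI [of _ "Suc s"] exI [of _ M]) simp
qed
end
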